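(* Let $B$ be an abelian group (written additively) with operators in a nonempty set $A$. Consider $B[x]$ as an abelian group with operators in $A[x]$. Then $B[x]$ is stably Noetherian if and only if $B$ is stably Noetherian (as a group with operators in $A$) and the action of $A$ on $B$ is weakly $s$-unital.
   Context: $\mathbb{N}=\{0,1,2,\ldots\}$, $\mathbb{N}_+=\{1,2,\ldots\}$. An abelian group $G$ has operators in a set $S$ if each $s\in S$ acts on $G$ (written $g\mapsto sg$) as a group endomorphism. A subgroup $H$ of $G$ is stable if $sh\in H$ for all $s\in S$, $h\in H$. $G$ is stably Noetherian if the set of stable subgroups of $G$, ordered by inclusion, satisfies the ascending chain condition. It is assumed that $A$ contains a fixed zero element, i.e. $0\in A$ with $0b=0$ for all $b\in B$. For $b\in B$ and $n\in\mathbb{N}_+$, $A^n b$ is the set of all $a_1(a_2(\cdots(a_nb)\cdots))$ with $a_1,\ldots,a_n\in A$. Let $[b]$ be the set of all finite nonempty sums $b_1+\cdots+b_r$ such that, for each $l$, $b_l$ or $-b_l$ lies in $\bigcup_{n\in\mathbb{N}_+}A^n b$. The action of $A$ on $B$ is weakly $s$-unital if $b\in[b]$ for every $b\in B$. $A[x]$ is the set of formal sums $\sum_{i\in\mathbb{N}}a_ix^i$ with $a_i\in A$, $a_i=0$ for all but finitely many $i$; $B[x]$ is defined likewise and is an abelian group under coefficientwise addition. Here $A[x]$ acts on $B[x]$ by $$\Bigl(\sum_{i}a_ix^i\Bigr)\Bigl(\sum_{j}b_jx^j\Bigr)=\sum_{i,j\in\mathbb{N}}(a_ib_j)x^{i+j}.$$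 *)

theory Defs
  imports "HOL-Computational_Algebra.Polynomial"
begin

text \<open>
  The operator set is the type of the first argument of the action, and an action of a set with
  zero is an action of a type of class \<open>zero\<close> (a type with a distinguished element and no
  further structure). Hence $A[x]$ and $B[x]$ are the library types \<open>'a poly\<close> and \<open>'b poly\<close>.
\<close>

locale group_with_operators =
  fixes act :: "'s \<Rightarrow> 'g::ab_group_add \<Rightarrow> 'g"
  assumes act_add: "act s (g + h) = act s g + act s h"

definition subgroup_add :: "'g::ab_group_add set \<Rightarrow> bool" where
  "subgroup_add H \<longleftrightarrow> 0 \<in> H \<and> (\<forall>g\<in>H. \<forall>h\<in>H. g + h \<in> H) \<and> (\<forall>g\<in>H. - g \<in> H)"

definition stable_subgroup :: "('s \<Rightarrow> 'g::ab_group_add \<Rightarrow> 'g) \<Rightarrow> 'g set \<Rightarrow> bool" where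
  "stable_subgroup act H \<longleftrightarrow> subgroup_add H \<and> (\<forall>s. \<forall>h\<in>H. act s h \<in> H)"

definition stably_Noetherian :: "('s \<Rightarrow> 'g::ab_group_add \<Rightarrow> 'g) \<Rightarrow> bool" where
  "stably_Noetherian act \<longleftrightarrow>
     (\<forall>H :: nat \<Rightarrow> 'g set.
        (\<forall>n. stable_subgroup act (H n)) \<and> (\<forall>n. H n \<subseteq> H (Suc n)) \<longrightarrow>
        (\<exists>N. \<forall>n\<ge>N. H n = H N))"

text \<open>$A^n b$: note that \<open>foldr act [a\<^sub>1, \<dots>, a\<^sub>n] b = act a\<^sub>1 (\<dots> (act a\<^sub>n b))\<close>.\<close>

definition act_pow :: "('s \<Rightarrow> 'g \<Rightarrow> 'g) \<Rightarrow> nat \<Rightarrow> 'g \<Rightarrow> 'g set" where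
  "act_pow act n b = {foldr act as b | as. length as = n}"

text \<open>The set $[b]$. It need not contain \<open>b\<close>, since only positive \<open>n\<close> occur.\<close>

definition act_span :: "('s \<Rightarrow> 'g::ab_group_add \<Rightarrow> 'g) \<Rightarrow> 'g \<Rightarrow> 'g set" where
  "act_span act b =
     {sum_list bs | bs. bs \<noteq> [] \<and>
        (\<forall>c\<in>set bs. c \<in> (\<Union>n\<in>{1..}. act_pow act n b) \<or> - c \<in> (\<Union>n\<in>{1..}. act_pow act n b))}"

definition weakly_s_unital :: "('s \<Rightarrow> 'g::ab_group_add \<Rightarrow> 'g) \<Rightarrow> bool" where
  "weakly_s_unital act \<longleftrightarrow> (\<forall>b. b \<in> act_span act b)"

text \<open>
  The action of $A[x]$ on $B[x]$. Cutting the double sum off at the degrees only omits zero terms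
  when \<open>act 0 b = 0\<close> and \<open>act a\<close> is additive; see \<open>coeff_poly_act\<close>.
\<close>

definition poly_act ::
  "('a::zero \<Rightarrow> 'b::ab_group_add \<Rightarrow> 'b) \<Rightarrow> 'a poly \<Rightarrow> 'b poly \<Rightarrow> 'b poly" where
  "poly_act act p q =
     (\<Sum>i\<le>degree p. \<Sum>j\<le>degree q. monom (act (coeff p i) (coeff q j)) (i + j))"

lemma (in group_with_operators) act_zero_right: "act s 0 = 0"
  using act_add[of s 0 0] by simp

lemma coeff_poly_act:
  fixes act :: "'a::zero \<Rightarrow> 'b::ab_group_add \<Rightarrow> 'b"
  assumes "group_with_operators act" and zero: "\<And>b. act 0 b = 0"
  shows "coeff (poly_act act p q) n = (\<Sum>i\<le>n. act (coeff p i) (coeff q (n - i)))"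
proof -
  interpret group_with_operators act by fact
  have inner: "(\<Sum>j\<le>degree q. if i + j = n then act (coeff p i) (coeff q j) else 0) =
      (if i \<le> n then act (coeff p i) (coeff q (n - i)) else 0)" for i
  proof (cases "i \<le> n")
    case True
    have "(\<Sum>j\<le>degree q. if i + j = n then act (coeff p i) (coeff q j) else 0) =
        (\<Sum>j\<le>degree q. if j = n - i then act (coeff p i) (coeff q j) else 0)"
      using True by (intro sum.cong) auto
    also have "\<dots> = act (coeff p i) (coeff q (n - i))"
      by (auto simp: coeff_eq_0 act_zero_right)
    finally show ?thesis using True by simp
  next
    case False
    then show ?thesis by (auto intro!: sum.neutral)
  qed
  have "coeff (poly_act act p q) n =
      (\<Sum>i\<le>degree p. if i \<le> n then act (coeff p i) (coeff q (n - i)) else 0)"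
    by (simp add: poly_act_def coeff_sum inner)
  also have "\<dots> = (\<Sum>i\<in>{..degree p} \<inter> {..n}. act (coeff p i) (coeff q (n - i)))"
    by (subst sum.inter_restrict) simp_all
  also have "\<dots> = (\<Sum>i\<le>n. act (coeff p i) (coeff q (n - i)))"
    by (intro sum.mono_neutral_left) (auto, metis le_degree zero)
  finally show ?thesis .
qed

lemma group_with_operators_poly_act:
  fixes act :: "'a::zero \<Rightarrow> 'b::ab_group_add \<Rightarrow> 'b"
  assumes "group_with_operators act" and "\<And>b. act 0 b = 0"
  shows "group_with_operators (poly_act act)"
proof
  fix p :: "'a poly" and q r :: "'b poly"
  show "poly_act act p (q + r) = poly_act act p q + poly_act act p r"
    by (rule poly_eqI)
      (simp add: coeff_poly_act[OF assms] group_with_operators.act_add[OF assms(1)] sum.distrib)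
qed

end

theory Submission imports Defs begin

text \<open>
  If $B$ is stably Noetherian and weakly $s$-unital, one argues as in Hilbert's basis theorem: for
  a stable subgroup $H$ of $B[x]$ the coefficients at $x^n$ of the elements of $H$ of degree at
  most $n$ form a stable subgroup $L_n(H)$ of $B$. Since $b \in [b]$, and every nonempty product of
  elements of $A$ can be applied to a polynomial with one extra factor $x$, the $L_n(H)$
  increase with $n$. For an ascending chain $H_k$ all $L_n(H_k)$ therefore become stationary
  simultaneously in $k$, and $H_k$ is determined by its $L_n(H_k)$ among the larger subgroups.

  Conversely, a chain in $B$ lifts to $B[x]$ coefficientwise. For $b \in B$ let
  $C = \{c \mid Ac \subseteq [b]\}$, which contains $b$ and $[b]$. The polynomials with coefficients
  in $C$ up to degree $n$ and in $[b]$ beyond form an ascending chain of stable subgroups; once it is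
  stationary at $N$, the element $b x^{N+1}$ shows that $b \in [b]$.
\<close>

section \<open>Subgroups, stable subgroups and bounds on \<open>act_span\<close>\<close>

lemma subgroup_add_zero: "subgroup_add H \<Longrightarrow> 0 \<in> H"
  and subgroup_add_add: "subgroup_add H \<Longrightarrow> g \<in> H \<Longrightarrow> h \<in> H \<Longrightarrow> g + h \<in> H"
  and subgroup_add_uminus: "subgroup_add H \<Longrightarrow> g \<in> H \<Longrightarrow> - g \<in> H"
  by (auto simp: subgroup_add_def)

lemma subgroup_add_diff: "subgroup_add H \<Longrightarrow> g \<in> H \<Longrightarrow> h \<in> H \<Longrightarrow> g - h \<in> H"
  using subgroup_add_add[of H g "- h"] subgroup_add_uminus[of H h] by simp

lemma subgroup_add_uminus_iff: "subgroup_add H \<Longrightarrow> - g \<in> H \<longleftrightarrow> g \<in> H"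
  using subgroup_add_uminus[of H g] subgroup_add_uminus[of H "- g"] by auto

lemma subgroup_add_sum:
  assumes "subgroup_add H" "\<And>x. x \<in> S \<Longrightarrow> f x \<in> H"
  shows "sum f S \<in> H"
  using assms(2)
  by (induction S rule: infinite_finite_induct)
    (auto intro: subgroup_add_zero[OF assms(1)] subgroup_add_add[OF assms(1)])

lemma subgroup_add_sum_list:
  assumes "subgroup_add H" "set xs \<subseteq> H"
  shows "sum_list xs \<in> H"
  using assms(2)
  by (induction xs)
    (auto intro: subgroup_add_zero[OF assms(1)] subgroup_add_add[OF assms(1)])

lemma subgroup_add_polys_with_coeffs:
  assumes "\<And>i. subgroup_add (K i)"
  shows "subgroup_add {f. \<forall>i. coeff f i \<in> K i}"
  using assms by (auto simp: subgroup_add_def)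

lemma stable_subgroupD:
  assumes "stable_subgroup act H"
  shows "subgroup_add H" and "h \<in> H \<Longrightarrow> act s h \<in> H"
  using assms by (auto simp: stable_subgroup_def)

lemma stable_subgroup_foldr:
  "stable_subgroup act H \<Longrightarrow> h \<in> H \<Longrightarrow> foldr act as h \<in> H"
  by (induction as) (auto intro: stable_subgroupD)

lemma stably_NoetherianD:
  assumes "stably_Noetherian act" "\<And>n. stable_subgroup act (H n)" "\<And>n. H n \<subseteq> H (Suc n)"
  obtains N where "\<And>n. n \<ge> N \<Longrightarrow> H n = H N"
  using assms unfolding stably_Noetherian_def by metis

lemma Union_act_pow: "(\<Union>n\<in>{1..}. act_pow act n b) = {foldr act as b | as. as \<noteq> []}"
  unfolding act_pow_def by (fastforce simp: Suc_le_eq)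

text \<open>In a nonempty product applied to \<open>b\<close>, the inner factors keep the result in
  \<open>H\<close> by stability, and the outermost factor then carries it into \<open>K\<close>.
  Closure of \<open>K\<close> under sums and negation gives the rest.\<close>

lemma act_span_subset:
  assumes "stable_subgroup act H" "b \<in> H" "subgroup_add K"
    and act_K: "\<And>s h. h \<in> H \<Longrightarrow> act s h \<in> K"
  shows "act_span act b \<subseteq> K"
proof -
  have pow: "c \<in> K" if c: "c \<in> (\<Union>n\<in>{1..}. act_pow act n b)" for c
  proof -
    obtain as where "as \<noteq> []" "c = foldr act as b"
      using c unfolding Union_act_pow by blast
    then obtain s as' where "c = act s (foldr act as' b)"
      by (cases as) auto
    then show ?thesis
      using stable_subgroup_foldr[OF assms(1,2)] act_K by simp
  qed
  show ?thesis
  proof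
    fix c assume "c \<in> act_span act b"
    then obtain bs where "c = sum_list bs"
      and bs: "\<And>d. d \<in> set bs \<Longrightarrow>
        d \<in> (\<Union>n\<in>{1..}. act_pow act n b) \<or> - d \<in> (\<Union>n\<in>{1..}. act_pow act n b)"
      unfolding act_span_def by blast
    moreover have "set bs \<subseteq> K"
      using bs pow subgroup_add_uminus_iff[OF assms(3)] by blast
    ultimately show "c \<in> K"
      using subgroup_add_sum_list[OF assms(3)] by simp
  qed
qed

section \<open>Leading coefficients\<close>

definition lead_coeffs :: "'b::ab_group_add poly set \<Rightarrow> nat \<Rightarrow> 'b set" where
  "lead_coeffs H n = {coeff f n | f. f \<in> H \<and> (\<forall>i>n. coeff f i = 0)}"

lemma lead_coeffsI:
  "f \<in> H \<Longrightarrow> (\<And>i. i > n \<Longrightarrow> coeff f i = 0) \<Longrightarrow> c = coeff f n \<Longrightarrow> c \<in> lead_coeffs H n"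
  unfolding lead_coeffs_def by blast

lemma lead_coeffsE:
  assumes "c \<in> lead_coeffs H n"
  obtains f where "f \<in> H" "\<And>i. i > n \<Longrightarrow> coeff f i = 0" "c = coeff f n"
  using assms unfolding lead_coeffs_def by blast

lemma lead_coeffs_mono: "H \<subseteq> K \<Longrightarrow> lead_coeffs H n \<subseteq> lead_coeffs K n"
  unfolding lead_coeffs_def by blast

lemma subgroup_add_lead_coeffs:
  assumes "subgroup_add H"
  shows "subgroup_add (lead_coeffs H n)"
  unfolding subgroup_add_def
proof (intro conjI ballI)
  show "0 \<in> lead_coeffs H n"
    by (rule lead_coeffsI[OF subgroup_add_zero[OF assms]]) auto
next
  fix g h assume "g \<in> lead_coeffs H n" "h \<in> lead_coeffs H n"
  then show "g + h \<in> lead_coeffs H n"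
    by (elim lead_coeffsE, intro lead_coeffsI[OF subgroup_add_add[OF assms]]) auto
next
  fix g assume "g \<in> lead_coeffs H n"
  then show "- g \<in> lead_coeffs H n"
    by (elim lead_coeffsE, intro lead_coeffsI[OF subgroup_add_uminus[OF assms]]) auto
qed

text \<open>From an element of \<open>H\<close> one subtracts an element of \<open>K\<close> with
  the same coefficient at the top index. The difference stays in \<open>H\<close> because
  \<open>K \<subseteq> H\<close>, and its degree bound has dropped, so the process ends at
  0.\<close>

lemma subset_if_lead_coeffs_subset:
  assumes H: "subgroup_add H" and K: "subgroup_add K" and "K \<subseteq> H"
    and lead: "\<And>n. lead_coeffs H n \<subseteq> lead_coeffs K n"
  shows "H \<subseteq> K"
proof -
  \<comment> \<open>A strict bound on the indices, instead of the degree, makes the zero polynomial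
    the case \<open>n = 0\<close>.\<close>
  have "f \<in> K" if "f \<in> H" "\<And>i. i \<ge> n \<Longrightarrow> coeff f i = 0" for f n
    using that
  proof (induction n arbitrary: f)
    case 0
    then have "f = 0" by (intro poly_eqI) simp
    then show ?case using subgroup_add_zero[OF K] by simp
  next
    case (Suc n)
    have "coeff f n \<in> lead_coeffs K n"
      using Suc.prems lead by (blast intro: lead_coeffsI Suc_leI)
    then obtain g where g: "g \<in> K" "\<And>i. i > n \<Longrightarrow> coeff g i = 0" "coeff f n = coeff g n"
      by (rule lead_coeffsE) blast
    have "f - g \<in> K"
    proof (rule Suc.IH)
      show "f - g \<in> H"
        using subgroup_add_diff[OF H] Suc.prems(1) g(1) \<open>K \<subseteq> H\<close> by blast
      show "coeff (f - g) i = 0" if "i \<ge> n" for i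
        using that g(2,3) Suc.prems(2)[of i] by (cases "i = n") auto
    qed
    then show ?case
      using subgroup_add_add[OF K _ g(1), of "f - g"] by simp
  qed
  \<comment> \<open>The bound is taken to be \<open>Suc (degree f)\<close>.\<close>
  then show ?thesis
    using coeff_eq_0[OF Suc_le_lessD] by blast
qed

section \<open>Stationary chains with two indices\<close>

lemma finite_stationary_chains:
  fixes F :: "nat \<Rightarrow> nat \<Rightarrow> 'c"
  assumes "\<And>n. \<exists>M. \<forall>k\<ge>M. F n k = F n M"
  shows "\<exists>M. \<forall>n<N. \<forall>k\<ge>M. F n k = F n M"
proof -
  obtain m where m: "\<And>n k. k \<ge> m n \<Longrightarrow> F n k = F n (m n)"
    using assms by metis
  define M where "M = Max (m ` {..N})"
  have "m n \<le> M" if "n < N" for n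
    using that by (auto simp: M_def)
  then show ?thesis
    using m by (metis order_trans)
qed

text \<open>Beyond the index \<open>N\<close> where the diagonal becomes stationary, every entry
  \<open>L n k\<close> is squeezed between \<open>L N N\<close> and the diagonal entry at
  \<open>max n k\<close>, which are equal. This leaves the finitely many rows below
  \<open>N\<close>, which have a common threshold.\<close>

lemma stationary_double_chain:
  fixes L :: "nat \<Rightarrow> nat \<Rightarrow> 'c::order"
  assumes mono1: "\<And>n n' k. n \<le> n' \<Longrightarrow> L n k \<le> L n' k"
    and mono2: "\<And>n k k'. k \<le> k' \<Longrightarrow> L n k \<le> L n k'"
    and row: "\<And>n. \<exists>M. \<forall>k\<ge>M. L n k = L n M"
    and diag: "\<exists>N. \<forall>n\<ge>N. L n n = L N N"
  shows "\<exists>M. \<forall>n. \<forall>k\<ge>M. L n k = L n M"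
proof -
  obtain N where N: "\<And>n. n \<ge> N \<Longrightarrow> L n n = L N N"
    using diag by blast
  obtain M where M: "\<And>n k. n < N \<Longrightarrow> k \<ge> M \<Longrightarrow> L n k = L n M"
    using finite_stationary_chains[of L N] row by blast
  have far: "L n k = L N N" if "n \<ge> N" "k \<ge> N" for n k
  proof (rule antisym)
    have "L n k \<le> L (max n k) (max n k)"
      by (meson mono1 mono2 max.cobounded1 max.cobounded2 order_trans)
    then show "L n k \<le> L N N"
      using N[of "max n k"] that by simp
    show "L N N \<le> L n k"
      by (meson mono1 mono2 that order_trans)
  qed
  have "L n k = L n (max M N)" if "k \<ge> max M N" for n k
  proof (cases "n < N")
    case True
    then show ?thesis using M[of n k] M[of n "max M N"] that by simp
  next
    case False
    then show ?thesis using far[of n k] far[of n "max M N"] that by simp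
  qed
  then show ?thesis by blast
qed

section \<open>Operators with a zero element and the span of an element\<close>

locale group_with_operators_zero = group_with_operators act
  for act :: "'a::zero \<Rightarrow> 'b::ab_group_add \<Rightarrow> 'b" +
  assumes act_zero_left: "act 0 b = 0"
begin

lemma act_uminus: "act s (- g) = - act s g"
  using act_add[of s g "- g"] by (simp add: act_zero_right eq_neg_iff_add_eq_0 add.commute)

lemma act_sum_list: "act s (sum_list bs) = sum_list (map (act s) bs)"
  by (induction bs) (simp_all add: act_zero_right act_add)

lemma act_in_act_span: "act s b \<in> act_span act b"
proof -
  have "act s b \<in> act_pow act 1 b"
    unfolding act_pow_def by (auto intro!: exI[of _ "[s]"])
  then show ?thesis
    unfolding act_span_def by (auto intro!: exI[of _ "[act s b]"])
qed

text \<open>Sums come from concatenating lists and negatives from negating entries. An operator is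
  prepended to each product, which stays nonempty.\<close>

lemma stable_subgroup_act_span: "stable_subgroup act (act_span act b)"
proof -
  define P where "P = (\<Union>n\<in>{1..}. act_pow act n b)"
  have act_P: "act s c \<in> P" if c: "c \<in> P" for s c
  proof -
    obtain as where "c = foldr act as b"
      using c unfolding P_def Union_act_pow by blast
    then have "act s c = foldr act (s # as) b"
      by simp
    then show ?thesis
      unfolding P_def Union_act_pow by blast
  qed
  have span: "act_span act b = {sum_list bs | bs. bs \<noteq> [] \<and> (\<forall>c\<in>set bs. c \<in> P \<or> - c \<in> P)}"
    unfolding act_span_def P_def ..
  have spanI: "c \<in> act_span act b"
    if "c = sum_list bs" "bs \<noteq> []" "\<And>d. d \<in> set bs \<Longrightarrow> d \<in> P \<or> - d \<in> P" for c bs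
    using that unfolding span by blast
  have spanE: thesis
    if "c \<in> act_span act b"
      "\<And>bs. c = sum_list bs \<Longrightarrow> bs \<noteq> [] \<Longrightarrow>
        (\<And>d. d \<in> set bs \<Longrightarrow> d \<in> P \<or> - d \<in> P) \<Longrightarrow> thesis"
    for c thesis
    using that unfolding span by blast
  show ?thesis
    unfolding stable_subgroup_def subgroup_add_def
  proof (intro conjI ballI allI)
    \<comment> \<open>The empty sum is excluded from the span, so 0 is obtained as
      \<open>act 0 b\<close>.\<close>
    show "0 \<in> act_span act b"
      using act_in_act_span[of 0] by (simp add: act_zero_left)
  next
    fix g h assume "g \<in> act_span act b" "h \<in> act_span act b"
    then obtain bs cs where
      "g = sum_list bs" "bs \<noteq> []" "\<And>d. d \<in> set bs \<Longrightarrow> d \<in> P \<or> - d \<in> P"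
      "h = sum_list cs" "cs \<noteq> []" "\<And>d. d \<in> set cs \<Longrightarrow> d \<in> P \<or> - d \<in> P"
      by (elim spanE) blast
    then show "g + h \<in> act_span act b"
      by (intro spanI[of _ "bs @ cs"]) auto
  next
    fix g assume "g \<in> act_span act b"
    then show "- g \<in> act_span act b"
    proof (rule spanE)
      fix bs
      assume bs: "g = sum_list bs" "bs \<noteq> []" "\<And>d. d \<in> set bs \<Longrightarrow> d \<in> P \<or> - d \<in> P"
      have "- g = sum_list (map uminus bs)"
        using uminus_sum_list_map[of id bs] bs(1) by simp
      moreover have "d \<in> P \<or> - d \<in> P" if "d \<in> set (map uminus bs)" for d
        using that bs(3)[of "- d"] by auto
      ultimately show ?thesis
        using bs(2) by (intro spanI[of _ "map uminus bs"]) auto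
    qed
  next
    fix s g assume "g \<in> act_span act b"
    then show "act s g \<in> act_span act b"
    proof (rule spanE)
      fix bs
      assume bs: "g = sum_list bs" "bs \<noteq> []" "\<And>d. d \<in> set bs \<Longrightarrow> d \<in> P \<or> - d \<in> P"
      then have "act s d \<in> P \<or> - act s d \<in> P" if "d \<in> set bs" for d
        using act_P that by (metis act_uminus)
      with bs(1,2) show ?thesis
        by (intro spanI[of _ "map (act s) bs"]) (auto simp: act_sum_list)
    qed
  qed
qed

section \<open>The polynomial action and leading coefficients\<close>

lemma coeff_act_poly:
  "coeff (poly_act act p q) n = (\<Sum>i\<le>n. act (coeff p i) (coeff q (n - i)))"
  by (rule coeff_poly_act[OF group_with_operators_axioms act_zero_left])

lemma coeff_poly_act_monom:
  "coeff (poly_act act (monom a k) q) n = (if k \<le> n then act a (coeff q (n - k)) else 0)"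
proof -
  have "coeff (poly_act act (monom a k) q) n =
      (\<Sum>i\<le>n. if i = k then act a (coeff q (n - k)) else 0)"
    unfolding coeff_act_poly by (intro sum.cong) (auto simp: act_zero_left)
  then show ?thesis by simp
qed

text \<open>The coefficient of a product at \<open>n\<close> involves only coefficients of the
  second factor at indices up to \<open>n\<close>, whence the condition
  \<open>i \<le> j\<close>.\<close>

lemma stable_subgroup_polys_with_coeffs:
  assumes sub: "\<And>i. subgroup_add (K i)"
    and act_K: "\<And>s h i j. h \<in> K i \<Longrightarrow> i \<le> j \<Longrightarrow> act s h \<in> K j"
  shows "stable_subgroup (poly_act act) {f. \<forall>i. coeff f i \<in> K i}"
  unfolding stable_subgroup_def
  by (auto simp: coeff_act_poly intro!: subgroup_add_polys_with_coeffs subgroup_add_sum sub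
      intro: act_K)

text \<open>The operator \<open>monom a k\<close> applies \<open>a\<close> and shifts by
  \<open>k\<close>. The case \<open>k = 0\<close> gives stability of \<open>lead_coeffs H n\<close>,
  and \<open>k = 1\<close> the passage to the next index.\<close>

lemma act_lead_coeffs:
  assumes "stable_subgroup (poly_act act) H" "c \<in> lead_coeffs H n"
  shows "act a c \<in> lead_coeffs H (n + k)"
proof -
  obtain f where "f \<in> H" "\<And>i. i > n \<Longrightarrow> coeff f i = 0" "c = coeff f n"
    using assms(2) by (rule lead_coeffsE) blast
  then show ?thesis
    by (intro lead_coeffsI[OF stable_subgroupD(2)[OF assms(1), of f "monom a k"]])
      (auto simp: coeff_poly_act_monom act_zero_right)
qed

lemma stable_subgroup_lead_coeffs:
  assumes "stable_subgroup (poly_act act) H"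
  shows "stable_subgroup act (lead_coeffs H n)"
  using subgroup_add_lead_coeffs[OF stable_subgroupD(1)[OF assms]]
    act_lead_coeffs[OF assms, of _ n _ 0]
  by (simp add: stable_subgroup_def)

lemma lead_coeffs_subset_Suc:
  assumes "weakly_s_unital act" "stable_subgroup (poly_act act) H"
  shows "lead_coeffs H n \<subseteq> lead_coeffs H (Suc n)"
proof
  fix b assume b: "b \<in> lead_coeffs H n"
  \<comment> \<open>Within each product the inner factors act as constants and only the outermost
    one carries a factor x, so the index rises by exactly one.\<close>
  have "act_span act b \<subseteq> lead_coeffs H (Suc n)"
    using act_lead_coeffs[OF assms(2), of _ n _ 1] stable_subgroupD(1)[OF assms(2)]
    by (intro act_span_subset[OF stable_subgroup_lead_coeffs[OF assms(2)] b])
      (auto intro: subgroup_add_lead_coeffs)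
  then show "b \<in> lead_coeffs H (Suc n)"
    using assms(1) by (auto simp: weakly_s_unital_def)
qed

section \<open>Ascent from B to B[x]\<close>

lemma stably_Noetherian_poly_act:
  assumes Noeth: "stably_Noetherian act" and unital: "weakly_s_unital act"
  shows "stably_Noetherian (poly_act act)"
  unfolding stably_Noetherian_def
proof (intro allI impI, elim conjE)
  fix H assume "\<forall>k. stable_subgroup (poly_act act) (H k)" "\<forall>k. H k \<subseteq> H (Suc k)"
  then have H: "stable_subgroup (poly_act act) (H k)" and H_Suc: "H k \<subseteq> H (Suc k)" for k
    by auto
  note H_mono = lift_Suc_mono_le[of H, OF H_Suc]
  define L where "L n k = lead_coeffs (H k) n" for n k
  have L_stable: "stable_subgroup act (L n k)" for n k
    unfolding L_def by (rule stable_subgroup_lead_coeffs[OF H])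
  have mono1: "L n k \<subseteq> L n' k" if "n \<le> n'" for n n' k
    using lift_Suc_mono_le[of "\<lambda>n. L n k", OF _ that] lead_coeffs_subset_Suc[OF unital H]
    unfolding L_def by blast
  have mono2: "L n k \<subseteq> L n k'" if "k \<le> k'" for n k k'
    unfolding L_def by (rule lead_coeffs_mono[OF H_mono[OF that]])
  have row: "\<exists>M. \<forall>k\<ge>M. L n k = L n M" for n
    using stably_NoetherianD[OF Noeth, of "L n"] L_stable mono2 by (metis le_SucI order_refl)
  \<comment> \<open>The diagonal is a single ascending chain in B; its stationarity handles all
    large \<open>n\<close> at once.\<close>
  have "L n n \<subseteq> L (Suc n) (Suc n)" for n
    using mono1[of n "Suc n" n] mono2[of n "Suc n" "Suc n"] by auto
  then have diag: "\<exists>N. \<forall>n\<ge>N. L n n = L N N"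
    using stably_NoetherianD[OF Noeth, of "\<lambda>n. L n n"] L_stable by metis
  obtain M where M: "\<And>n k. k \<ge> M \<Longrightarrow> L n k = L n M"
    using stationary_double_chain[of L, OF mono1 mono2 row diag] by blast
  have "H k = H M" if "k \<ge> M" for k
  proof (rule antisym)
    show "H M \<subseteq> H k" by (rule H_mono[OF that])
    show "H k \<subseteq> H M"
    proof (rule subset_if_lead_coeffs_subset)
      show "lead_coeffs (H k) n \<subseteq> lead_coeffs (H M) n" for n
        using M[OF that, of n] by (simp add: L_def)
    qed (use H H_mono[OF that] stable_subgroupD(1) in blast)+
  qed
  then show "\<exists>N. \<forall>n\<ge>N. H n = H N" by blast
qed

section \<open>Descent from B[x] to B\<close>

lemma stably_Noetherian_of_poly_act:
  assumes "stably_Noetherian (poly_act act)"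
  shows "stably_Noetherian act"
  unfolding stably_Noetherian_def
proof (intro allI impI, elim conjE)
  fix H assume "\<forall>n. stable_subgroup act (H n)" "\<forall>n. H n \<subseteq> H (Suc n)"
  then have H: "stable_subgroup act (H n)" and H_Suc: "H n \<subseteq> H (Suc n)" for n
    by auto
  define P where "P n = {f. \<forall>i. coeff f i \<in> H n}" for n
  \<comment> \<open>Constant polynomials recover \<open>H n\<close> from \<open>P n\<close>.\<close>
  have P_iff: "monom h 0 \<in> P n \<longleftrightarrow> h \<in> H n" for h n
    using subgroup_add_zero[OF stable_subgroupD(1)[OF H]] by (auto simp: P_def)
  obtain N where "\<And>n. n \<ge> N \<Longrightarrow> P n = P N"
  proof (rule stably_NoetherianD[OF assms, of P])
    show "stable_subgroup (poly_act act) (P n)" for n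
      unfolding P_def
      by (rule stable_subgroup_polys_with_coeffs) (auto intro: stable_subgroupD[OF H])
    show "P n \<subseteq> P (Suc n)" for n
      using H_Suc by (auto simp: P_def)
  qed blast
  then have "\<forall>n\<ge>N. H n = H N"
    using P_iff by (metis set_eqI)
  then show "\<exists>N. \<forall>n\<ge>N. H n = H N" ..
qed

lemma weakly_s_unital_of_poly_act:
  assumes "stably_Noetherian (poly_act act)"
  shows "weakly_s_unital act"
  unfolding weakly_s_unital_def
proof
  fix b
  define S where "S = act_span act b"
  define C where "C = {c. \<forall>s. act s c \<in> S}"
  have S: "stable_subgroup act S"
    unfolding S_def by (rule stable_subgroup_act_span)
  note S_sub = stable_subgroupD(1)[OF S]
  have C_sub: "subgroup_add C"
    using S_sub by (auto simp: C_def subgroup_add_def act_zero_right act_add act_uminus)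
  have S_le_C: "S \<subseteq> C"
    using stable_subgroupD(2)[OF S] by (auto simp: C_def)
  have b_C: "b \<in> C"
    by (simp add: C_def S_def act_in_act_span)
  define K where "K n i = (if i \<le> n then C else S)" for n i :: nat
  define H where "H n = {f. \<forall>i. coeff f i \<in> K n i}" for n
  obtain N where N: "\<And>n. n \<ge> N \<Longrightarrow> H n = H N"
  proof (rule stably_NoetherianD[OF assms, of H])
    show "stable_subgroup (poly_act act) (H n)" for n
      unfolding H_def
    proof (rule stable_subgroup_polys_with_coeffs)
      show "subgroup_add (K n i)" for i
        using C_sub S_sub by (simp add: K_def)
      \<comment> \<open>One application of an operator takes \<open>C\<close> into \<open>S\<close>,
        which is contained in every \<open>K n j\<close>.\<close>
      show "act s h \<in> K n j" if "h \<in> K n i" for s h i j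
      proof -
        have "h \<in> C"
          using that S_le_C by (auto simp: K_def split: if_splits)
        then have "act s h \<in> S"
          by (simp add: C_def)
        then show ?thesis
          using S_le_C by (auto simp: K_def)
      qed
    qed
    have "K n i \<subseteq> K (Suc n) i" for n i
      using S_le_C by (auto simp: K_def)
    then show "H n \<subseteq> H (Suc n)" for n
      by (auto simp: H_def)
  qed blast
  \<comment> \<open>The index \<open>Suc N\<close> is the last one where \<open>H (Suc N)\<close>
    allows coefficients in \<open>C\<close>, and the first where \<open>H N\<close> demands
    coefficients in \<open>S\<close>.\<close>
  have "monom b (Suc N) \<in> H (Suc N)"
    using b_C subgroup_add_zero[OF C_sub] subgroup_add_zero[OF S_sub] by (simp add: H_def K_def)
  then have "monom b (Suc N) \<in> H N"
    using N[of "Suc N"] by simp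
  then have "coeff (monom b (Suc N)) (Suc N) \<in> K N (Suc N)"
    unfolding H_def by blast
  then show "b \<in> act_span act b"
    by (simp add: K_def S_def)
qed

end

theorem theorem35:
  fixes act :: "'a::zero \<Rightarrow> 'b::ab_group_add \<Rightarrow> 'b"
  assumes "group_with_operators act"
    and "\<And>b. act 0 b = 0"
  shows "stably_Noetherian (poly_act act) \<longleftrightarrow> stably_Noetherian act \<and> weakly_s_unital act"
proof -
  interpret group_with_operators_zero act
    using assms by (simp add: group_with_operators_zero_def group_with_operators_zero_axioms_def)
  show ?thesis
    using stably_Noetherian_poly_act stably_Noetherian_of_poly_act weakly_s_unital_of_poly_act
    by blast
qed

end
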